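(* Let $G$ be a graph, let $\sigma$ be a vertex ordering of $G$, and let $d\in \mathbb{N}$. Then there exists a clustering $\mathcal{X}$ of $G^d$ such that $$\mathrm{wcol}_r(G^d/\mathcal{X})\leq \mathrm{wcol}_{2dr}(G,\sigma)\qquad \text{for all } r\in \mathbb{N}.$$
   Context: All graphs are finite, simple and undirected; $\mathbb{N}$ denotes the nonnegative integers. For $d\in\mathbb{N}$, the $d$th power $G^d$ of $G$ is the graph on $V(G)$ in which distinct $u,v$ are adjacent iff their distance in $G$ is at most $d$. A vertex ordering $\sigma$ of $G$ is a linear order on $V(G)$; write $u<_\sigma v$ if $u$ is before $v$. For $r\in\mathbb{N}$ and vertices $u,v$ with $v\leq_\sigma u$, $v$ is weakly $r$-reachable from $u$ if there is a path of length (number of edges) at most $r$ from $u$ to $v$ all of whose vertices are not placed before $v$ in $\sigma$; $\mathrm{WReach}_r[G,\sigma,u]$ is the set of vertices weakly $r$-reachable from $u$ (it contains $u$). The weak $r$-coloring number of $\sigma$ is $\mathrm{wcol}_r(G,\sigma)=\max_{u\in V(G)}|\mathrm{WReach}_r[G,\sigma,u]|$, and $\mathrm{wcol}_r(G)$ is the minimum of $\mathrm{wcol}_r(G,\sigma)$ over all vertex orderings $\sigma$ of $G$. A clustering of a graph $H$ is a partition $\mathcal{X}$ of $V(H)$ into nonempty blocks each of which is a clique in $H$. The quotient graph $H/\mathcal{X}$ has vertex set $\mathcal{X}$, with distinct blocks $A,B$ adjacent iff some $u\in A$ and $v\in B$ are adjacent in $H$. *)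

theory Defs
  imports "Graph_Theory.Graph_Theory" "HOL-Library.Disjoint_Sets"
begin

text \<open>
  A finite simple undirected graph is a \<open>pair_graph\<close>: a finite loop-free digraph without parallel
  arcs whose arc relation is symmetric.  A vertex ordering of \<open>G\<close> is a relation \<open>\<sigma>\<close> with
  \<open>linear_order_on (pverts G) \<sigma>\<close>, where \<open>(u, v) \<in> \<sigma>\<close> means that \<open>u\<close> equals \<open>v\<close> or is before \<open>v\<close>.
\<close>

text \<open>The infinite value (for vertices in different components) is possible, hence \<open>ereal\<close>.\<close>

definition graph_dist :: "'a pair_pre_digraph \<Rightarrow> 'a \<Rightarrow> 'a \<Rightarrow> ereal" where
  "graph_dist G u v = wf_digraph.\<mu> (with_proj G) (\<lambda>_. 1) u v"

definition graph_power :: "'a pair_pre_digraph \<Rightarrow> nat \<Rightarrow> 'a pair_pre_digraph" where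
  "graph_power G d = \<lparr> pverts = pverts G,
     parcs = {(u, v). u \<in> pverts G \<and> v \<in> pverts G \<and> u \<noteq> v \<and> graph_dist G u v \<le> ereal (real d)} \<rparr>"

definition WReach :: "nat \<Rightarrow> 'a pair_pre_digraph \<Rightarrow> 'a rel \<Rightarrow> 'a \<Rightarrow> 'a set" where
  "WReach r G \<sigma> u = {v. (v, u) \<in> \<sigma> \<and>
     (\<exists>p. pre_digraph.apath (with_proj G) u p v \<and> length p \<le> r \<and>
       (\<forall>w \<in> set (pre_digraph.awalk_verts (with_proj G) u p). (v, w) \<in> \<sigma>))}"

text \<open>
  On \<open>nat\<close>, \<open>SUP\<close> over a nonempty finite family is the maximum and \<open>INF\<close> over a nonempty family is
  the minimum.  For the graph without vertices the maximum is read as \<open>0\<close>, the value of the empty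
  \<open>SUP\<close>.
\<close>

definition wcol_ord :: "nat \<Rightarrow> 'a pair_pre_digraph \<Rightarrow> 'a rel \<Rightarrow> nat" where
  "wcol_ord r G \<sigma> = (SUP u \<in> pverts G. card (WReach r G \<sigma> u))"

definition wcol :: "nat \<Rightarrow> 'a pair_pre_digraph \<Rightarrow> nat" where
  "wcol r G = (INF \<sigma> \<in> {\<sigma>. linear_order_on (pverts G) \<sigma>}. wcol_ord r G \<sigma>)"

definition is_clique :: "'a pair_pre_digraph \<Rightarrow> 'a set \<Rightarrow> bool" where
  "is_clique H A \<longleftrightarrow> A \<subseteq> pverts H \<and> (\<forall>u \<in> A. \<forall>v \<in> A. u \<noteq> v \<longrightarrow> (u, v) \<in> parcs H)"

definition clustering :: "'a pair_pre_digraph \<Rightarrow> 'a set set \<Rightarrow> bool" where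
  "clustering H X \<longleftrightarrow> partition_on (pverts H) X \<and> (\<forall>A \<in> X. is_clique H A)"

definition quotient_graph :: "'a pair_pre_digraph \<Rightarrow> 'a set set \<Rightarrow> 'a set pair_pre_digraph" where
  "quotient_graph H X = \<lparr> pverts = X,
     parcs = {(A, B). A \<in> X \<and> B \<in> X \<and> A \<noteq> B \<and> (\<exists>u \<in> A. \<exists>v \<in> B. (u, v) \<in> parcs H)} \<rparr>"

lemma graph_dist_le_iff:
  assumes "pair_graph G"
  shows "graph_dist G u v \<le> ereal (real d) \<longleftrightarrow>
    (\<exists>p. pre_digraph.awalk (with_proj G) u p v \<and> length p \<le> d)"
proof -
  interpret pair_graph G by fact
  have cost: "awalk_cost (\<lambda>_. 1) p = real (length p)" for p :: "('a \<times> 'a) list"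
    by (induction p) (auto simp: awalk_cost_def)
  have mu: "graph_dist G u v = (INF p \<in> {p. awalk u p v}. ereal (real (length p)))"
    unfolding graph_dist_def \<mu>_def cost ..
  show ?thesis
  proof
    assume le: "graph_dist G u v \<le> ereal (real d)"
    have "ereal (real d) < ereal (real (Suc d))" by simp
    with le have "(INF p \<in> {p. awalk u p v}. ereal (real (length p))) < ereal (real (Suc d))"
      unfolding mu by (rule le_less_trans)
    then obtain p where "awalk u p v" "length p < Suc d"
      unfolding INF_less_iff by auto
    then show "\<exists>p. awalk u p v \<and> length p \<le> d" by auto
  next
    assume "\<exists>p. awalk u p v \<and> length p \<le> d"
    then obtain p where "awalk u p v" "length p \<le> d" by auto
    then show "graph_dist G u v \<le> ereal (real d)"
      unfolding mu by (intro INF_lower2[of p]) auto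
  qed
qed

lemma pair_graph_graph_power:
  assumes "pair_graph G"
  shows "pair_graph (graph_power G d)"
proof -
  interpret pair_graph G by fact
  have sym: "\<exists>q. awalk v q u \<and> length q \<le> d" if "awalk u p v" "length p \<le> d" for u v p
  proof -
    have "\<exists>q. awalk v q u \<and> length q = length p" using that(1)
    proof (induction p arbitrary: u)
      case Nil
      then show ?case by (intro exI[of _ "[]"]) (auto simp: awalk_def)
    next
      case (Cons e p)
      obtain x y where e: "e = (x, y)" by (cases e)
      from Cons.prems have "x = u" "(u, y) \<in> parcs G" "awalk y p v"
        by (auto simp: e awalk_Cons_iff)
      moreover then obtain q where "awalk v q y" "length q = length p" using Cons.IH by blast
      moreover have "(y, u) \<in> parcs G"
        using \<open>(u, y) \<in> parcs G\<close> pair_sym_arcs by (auto simp: symmetric_def dest: symD)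
      moreover then have "awalk y [(y, u)] u" 
        by (auto simp: awalk_def intro: in_arcsD1 in_arcsD2)
      ultimately show ?case by (intro exI[of _ "q @ [(y, u)]"]) auto
    qed
    with that(2) show ?thesis by auto
  qed
  have "parcs (graph_power G d) \<subseteq> pverts G \<times> pverts G" by (auto simp: graph_power_def)
  then have "finite (parcs (graph_power G d))"
    using pair_finite_verts by (meson finite_SigmaI finite_subset)
  then show ?thesis
    using pair_finite_verts sym
    by unfold_locales
      (auto simp: graph_power_def graph_dist_le_iff[OF assms] symmetric_def intro!: symI)
qed

lemma pair_graph_quotient_graph:
  assumes "pair_graph H" "partition_on (pverts H) X"
  shows "pair_graph (quotient_graph H X)"
proof -
  interpret pair_graph H by fact
  have fin: "finite X" using finite_elements[OF pair_finite_verts assms(2)] .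
  have "parcs (quotient_graph H X) \<subseteq> X \<times> X" by (auto simp: quotient_graph_def)
  then have "finite (parcs (quotient_graph H X))" using fin by (meson finite_SigmaI finite_subset)
  moreover have "(v, u) \<in> parcs H" if "(u, v) \<in> parcs H" for u v
    using that pair_sym_arcs by (auto simp: symmetric_def dest: symD)
  ultimately show ?thesis
    using fin
    by unfold_locales (auto simp: quotient_graph_def symmetric_def intro!: symI)
qed

end

theory Submission
  imports Defs
begin

text \<open>
  Let \<open>k = d div 2\<close> and let \<open>c u\<close> be the \<open>\<sigma>\<close>-least vertex within distance \<open>k\<close> of \<open>u\<close>.  Vertices with
  the same \<open>c\<close> are at distance at most \<open>2 * k \<le> d\<close>, so the fibres of \<open>c\<close> form a clustering; order them
  by their centres \<open>c\<close>.  An edge of the quotient comes from vertices \<open>u\<close>, \<open>v\<close> at distance at most \<open>d\<close>,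
  and gives a walk from \<open>c u\<close> via \<open>u\<close> and \<open>v\<close> to \<open>c v\<close> of length at most \<open>k + d + k \<le> 2 * d\<close>.  As
  \<open>d \<le> 2 * k + 1\<close>, all its vertices are within distance \<open>k\<close> of \<open>u\<close> or \<open>v\<close>, hence none of them is
  before both \<open>c u\<close> and \<open>c v\<close>.  So weak \<open>r\<close>-reachability of clusters implies weak
  \<open>2 * d * r\<close>-reachability of their centres.
\<close>

section \<open>Linear orders: least elements and pullbacks\<close>

lemma linear_order_on_finite_least:
  assumes "linear_order_on V r" "finite S" "S \<noteq> {}" "S \<subseteq> V"
  shows "\<exists>m\<in>S. \<forall>w\<in>S. (m, w) \<in> r"
  using assms(2-4)
proof (induction S rule: finite_ne_induct)
  case (singleton x)
  then show ?case using assms(1) by (auto simp: order_on_defs refl_on_def)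
next
  case (insert x F)
  then obtain m where m: "m \<in> F" "\<forall>w\<in>F. (m, w) \<in> r" by auto
  have refl: "(x, x) \<in> r" and tr: "trans r"
    using assms(1) insert.prems by (auto simp: order_on_defs refl_on_def)
  have "(x, m) \<in> r \<or> (m, x) \<in> r"
    using assms(1) insert.prems m(1) refl by (cases "x = m") (auto simp: order_on_defs total_on_def)
  then show ?case
  proof
    assume "(x, m) \<in> r"
    then show ?thesis using m(2) refl tr by (auto dest: transD)
  next
    assume "(m, x) \<in> r"
    then show ?thesis using m by auto
  qed
qed

text \<open>Used to order the clusters by their centres. Injectivity of \<open>f\<close> yields
  antisymmetry, and it yields totality because distinct elements have distinct, hence comparable,
  images.\<close>

lemma linear_order_on_inj_pullback:
  assumes "linear_order_on V r" "inj_on f X" "f ` X \<subseteq> V"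
  shows "linear_order_on X {(x, y). x \<in> X \<and> y \<in> X \<and> (f x, f y) \<in> r}"
proof -
  have r: "refl_on V r" "trans r" "antisym r" "total_on V r"
    using assms(1) by (auto simp: order_on_defs)
  show ?thesis
    unfolding order_on_defs
  proof (intro conjI)
    show "refl_on X {(x, y). x \<in> X \<and> y \<in> X \<and> (f x, f y) \<in> r}"
      using r(1) assms(3) by (auto simp: refl_on_def)
    show "trans {(x, y). x \<in> X \<and> y \<in> X \<and> (f x, f y) \<in> r}"
      using r(2) by (auto simp: trans_def)
    show "antisym {(x, y). x \<in> X \<and> y \<in> X \<and> (f x, f y) \<in> r}"
      using r(3) assms(2) by (auto simp: antisym_def dest: inj_onD)
    show "total_on X {(x, y). x \<in> X \<and> y \<in> X \<and> (f x, f y) \<in> r}"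
      using r(4) assms(2,3) unfolding total_on_def inj_on_def image_subset_iff mem_Collect_eq prod.case
      by blast
  qed auto
qed

section \<open>Walks: shortening and reversal\<close>

lemma (in wf_digraph) start_in_awalk_verts: "awalk u p v \<Longrightarrow> u \<in> set (awalk_verts u p)"
  by (cases p) (auto simp: awalk_Cons_iff)

text \<open>\<open>WReach\<close> asks for paths, whereas concatenation only gives walks. While a
  vertex repeats, a nonempty closed subwalk can be cut out; this shortens the walk and adds no
  vertex, so lower bounds on its vertices survive.\<close>

lemma (in wf_digraph) awalk_imp_shorter_apath:
  assumes "awalk u p v"
  shows "\<exists>q. apath u q v \<and> length q \<le> length p \<and> set (awalk_verts u q) \<subseteq> set (awalk_verts u p)"
  using assms
proof (induction p rule: length_induct)
  case (1 p)
  show ?case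
  proof (cases "distinct (awalk_verts u p)")
    case True
    then show ?thesis using "1.prems" by (auto simp: apath_def)
  next
    case False
    from awalk_not_distinct_decomp[OF "1.prems" False] obtain q r s w
      where p: "p = q @ r @ s" "0 < length r" "awalk u q w" "awalk w r w" "awalk w s v"
      by blast
    have qs: "awalk u (q @ s) v" "length (q @ s) < length p" using p by auto
    have "set (awalk_verts u (q @ s)) \<subseteq> set (awalk_verts u p)"
      using p set_awalk_verts_append[OF p(3,5)] set_awalk_verts_append[OF p(4,5)]
        set_awalk_verts_append[OF p(3), of "r @ s" v] by auto
    with "1.IH" qs show ?thesis by (meson less_imp_le order_trans)
  qed
qed

context pair_graph
begin

lemma awalk_reverse:
  assumes "awalk u p v"
  shows "\<exists>q. awalk v q u \<and> length q = length p \<and> set (awalk_verts v q) = set (awalk_verts u p)"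
  using assms
proof (induction p arbitrary: u)
  case Nil
  then show ?case by (intro exI[of _ "[]"]) (auto simp: awalk_def)
next
  case (Cons e p)
  obtain x y where e: "e = (x, y)" by (cases e)
  from Cons.prems have xy: "x = u" "(u, y) \<in> parcs G" "awalk y p v"
    by (auto simp: e awalk_Cons_iff)
  from Cons.IH[OF xy(3)] obtain q where
    q: "awalk v q y" "length q = length p" "set (awalk_verts v q) = set (awalk_verts y p)"
    by blast
  have "(y, u) \<in> parcs G"
    using xy(2) pair_sym_arcs by (auto simp: symmetric_def dest: symD)
  then have yu: "awalk y [(y, u)] u"
    by (auto simp: awalk_def intro: in_arcsD1 in_arcsD2)
  have "y \<in> set (awalk_verts y p)" using xy(3) by (rule start_in_awalk_verts)
  with q yu xy set_awalk_verts_append[OF q(1) yu] show ?case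
    by (intro exI[of _ "q @ [(y, u)]"]) (auto simp: e)
qed

section \<open>Balls of bounded radius in \<open>G\<close>\<close>

definition near :: "nat \<Rightarrow> 'a \<Rightarrow> 'a \<Rightarrow> bool" where
  "near k u v \<longleftrightarrow> (\<exists>p. awalk u p v \<and> length p \<le> k)"

lemma near_refl: "u \<in> pverts G \<Longrightarrow> near k u u"
  unfolding near_def by (intro exI[of _ "[]"]) (auto simp: awalk_def)

lemma near_sym: "near k u v \<Longrightarrow> near k v u"
  unfolding near_def by (metis awalk_reverse)

lemma near_trans: "near k u v \<Longrightarrow> near l v w \<Longrightarrow> near (k + l) u w"
  unfolding near_def by (metis add_mono awalk_appendI length_append)

lemma near_mono: "near k u v \<Longrightarrow> k \<le> l \<Longrightarrow> near l u v"
  unfolding near_def by fastforce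

lemma near_verts: "near k u v \<Longrightarrow> u \<in> pverts G \<and> v \<in> pverts G"
  by (auto simp: near_def dest: awalk_hd_in_verts awalk_last_in_verts)

text \<open>Splitting at \<open>w\<close> leaves two pieces of total length at most
  \<open>k + l + 1\<close>, so they cannot have lengths at least \<open>k + 1\<close> and at least
  \<open>l + 1\<close> at once. The extra 1 is what covers odd \<open>d\<close> later.\<close>

lemma near_awalk_verts:
  assumes "awalk u p v" "length p \<le> k + l + 1" "w \<in> set (awalk_verts u p)"
  shows "near k u w \<or> near l w v"
proof -
  from awalk_decomp[OF assms(1,3)] obtain q r
    where "p = q @ r" "awalk u q w" "awalk w r v" by blast
  moreover from this assms(2) have "length q \<le> k \<or> length r \<le> l" by auto
  ultimately show ?thesis unfolding near_def by blast
qed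

lemma parcs_graph_power:
  "(u, v) \<in> parcs (graph_power G d) \<longleftrightarrow> u \<noteq> v \<and> near d u v"
  using near_verts
  by (auto simp: graph_power_def graph_dist_le_iff[OF pair_graph_axioms] near_def)

text \<open>The bound \<open>b\<close> is kept apart from the endpoints so that walks with a common
  bound can be concatenated. Weak reachability is the case where \<open>b\<close> is the final
  vertex.\<close>

definition walk_above :: "'a rel \<Rightarrow> 'a \<Rightarrow> nat \<Rightarrow> 'a \<Rightarrow> 'a \<Rightarrow> bool" where
  "walk_above \<sigma> b n u v \<longleftrightarrow>
    (\<exists>p. awalk u p v \<and> length p \<le> n \<and> (\<forall>w\<in>set (awalk_verts u p). (b, w) \<in> \<sigma>))"

lemma walk_above_trans:
  assumes "walk_above \<sigma> b m u v" "walk_above \<sigma> b n v w"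
  shows "walk_above \<sigma> b (m + n) u w"
proof -
  from assms obtain p q where
    "awalk u p v" "length p \<le> m" "\<forall>w\<in>set (awalk_verts u p). (b, w) \<in> \<sigma>"
    "awalk v q w" "length q \<le> n" "\<forall>w\<in>set (awalk_verts v q). (b, w) \<in> \<sigma>"
    unfolding walk_above_def by blast
  then show ?thesis unfolding walk_above_def
    using set_awalk_verts_append[of u p v q w] by (intro exI[of _ "p @ q"]) auto
qed

lemma walk_above_mono: "walk_above \<sigma> b m u v \<Longrightarrow> m \<le> n \<Longrightarrow> walk_above \<sigma> b n u v"
  unfolding walk_above_def by fastforce

lemma walk_above_sym: "walk_above \<sigma> b n u v \<Longrightarrow> walk_above \<sigma> b n v u"
  unfolding walk_above_def by (metis awalk_reverse)

lemma walk_aboveI: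
  assumes "near n u v" "n \<le> k + l + 1"
    and "\<And>w. near k u w \<Longrightarrow> (b, w) \<in> \<sigma>" "\<And>w. near l v w \<Longrightarrow> (b, w) \<in> \<sigma>"
  shows "walk_above \<sigma> b n u v"
proof -
  from assms(1) obtain p where "awalk u p v" "length p \<le> n" unfolding near_def by blast
  moreover from this assms(2-4) have "\<forall>w\<in>set (awalk_verts u p). (b, w) \<in> \<sigma>"
    using near_awalk_verts near_sym by (meson order_trans)
  ultimately show ?thesis unfolding walk_above_def by blast
qed

section \<open>Weak reachability through walks, and weak coloring numbers\<close>

lemma WReachI:
  assumes "walk_above \<sigma> v n u v"
  shows "v \<in> WReach n G \<sigma> u"
proof -
  from assms obtain p where
    p: "awalk u p v" "length p \<le> n" "\<forall>w\<in>set (awalk_verts u p). (v, w) \<in> \<sigma>"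
    unfolding walk_above_def by blast
  from awalk_imp_shorter_apath[OF p(1)] obtain q where
    "apath u q v" "length q \<le> length p" "set (awalk_verts u q) \<subseteq> set (awalk_verts u p)" by blast
  moreover have "(v, u) \<in> \<sigma>" using p(3) start_in_awalk_verts[OF p(1)] by (rule bspec)
  ultimately show ?thesis using p by (force simp: WReach_def)
qed

lemma WReachD:
  assumes "v \<in> WReach n G \<sigma> u"
  shows "walk_above \<sigma> v n u v"
  using assms by (auto simp: WReach_def walk_above_def dest: awalkI_apath)

lemma card_WReach_le_wcol_ord:
  assumes "u \<in> pverts G"
  shows "card (WReach r G \<sigma> u) \<le> wcol_ord r G \<sigma>"
  unfolding wcol_ord_def using assms pair_finite_verts by (intro cSUP_upper) auto

lemma finite_WReach:
  assumes "linear_order_on (pverts G) \<sigma>"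
  shows "finite (WReach r G \<sigma> u)"
proof (rule finite_subset[OF _ pair_finite_verts])
  show "WReach r G \<sigma> u \<subseteq> pverts G"
    using assms by (auto simp: WReach_def order_on_defs)
qed

end

text \<open>Since \<open>f\<close> embeds every weakly reachable set of \<open>Q\<close> into one of
  \<open>G\<close>, cardinalities carry over, and \<open>\<tau>\<close> is one of the orderings over
  which \<open>wcol r Q\<close> is minimal.\<close>

lemma wcol_le_by_injection:
  assumes G: "pair_graph G" "linear_order_on (pverts G) \<sigma>"
    and Q: "pair_graph Q" "linear_order_on (pverts Q) \<tau>"
    and inj: "inj_on f (pverts Q)" "f ` pverts Q \<subseteq> pverts G"
    and reach: "\<And>A B. A \<in> pverts Q \<Longrightarrow> B \<in> WReach r Q \<tau> A \<Longrightarrow> f B \<in> WReach s G \<sigma> (f A)"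
  shows "wcol r Q \<le> wcol_ord s G \<sigma>"
proof -
  have "card (WReach r Q \<tau> A) \<le> wcol_ord s G \<sigma>" if A: "A \<in> pverts Q" for A
  proof -
    have "WReach r Q \<tau> A \<subseteq> pverts Q" using Q(2) by (auto simp: WReach_def order_on_defs)
    then have "card (WReach r Q \<tau> A) \<le> card (WReach s G \<sigma> (f A))"
      using A inj(1) reach pair_graph.finite_WReach[OF G]
      by (intro card_inj_on_le[of f]) (auto intro: inj_on_subset)
    also have "\<dots> \<le> wcol_ord s G \<sigma>"
      using A inj(2) by (intro pair_graph.card_WReach_le_wcol_ord[OF G(1)]) auto
    finally show ?thesis .
  qed
  then have "wcol_ord r Q \<tau> \<le> wcol_ord s G \<sigma>"
    \<comment> \<open>\<open>cSUP_least\<close> needs a nonempty index set; without vertices the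
      supremum has the default value 0.\<close>
    by (cases "pverts Q = {}") (simp add: wcol_ord_def Sup_nat_def,
      simp add: wcol_ord_def[of r Q] cSUP_least)
  moreover have "wcol r Q \<le> wcol_ord r Q \<tau>"
    unfolding wcol_def using Q(2) by (intro cINF_lower) auto
  ultimately show ?thesis by simp
qed

theorem theorem3p2:
  fixes G :: "'a pair_pre_digraph" and \<sigma> :: "'a rel" and d :: nat
  assumes "pair_graph G"
    and "linear_order_on (pverts G) \<sigma>"
  shows "\<exists>X. clustering (graph_power G d) X \<and>
    (\<forall>r. wcol r (quotient_graph (graph_power G d) X) \<le> wcol_ord (2 * d * r) G \<sigma>)"
proof -
  interpret pair_graph G by fact
  define k where "k = d div 2"
  \<comment> \<open>The first bound makes fibres of \<open>c\<close> cliques and gives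
    \<open>k + d + k \<le> 2 * d\<close>; the second, tight for odd \<open>d\<close>, lets two balls
    of radius \<open>k\<close> cover a walk of length \<open>d\<close>.\<close>
  have k: "2 * k \<le> d" "d \<le> k + k + 1" by (auto simp: k_def)
  have "\<exists>c. near k u c \<and> (\<forall>w. near k u w \<longrightarrow> (c, w) \<in> \<sigma>)" if "u \<in> pverts G" for u
  proof -
    have "{w. near k u w} \<subseteq> pverts G" "{w. near k u w} \<noteq> {}"
      using near_verts near_refl[OF that] by blast+
    with linear_order_on_finite_least[OF assms(2)] show ?thesis
      by (metis finite_subset mem_Collect_eq pair_finite_verts)
  qed
  then obtain c where c: "\<And>u. u \<in> pverts G \<Longrightarrow> near k u (c u)"
    and c_least: "\<And>u w. u \<in> pverts G \<Longrightarrow> near k u w \<Longrightarrow> (c u, w) \<in> \<sigma>"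
    by metis
  have trans: "trans \<sigma>" using assms(2) by (auto simp: order_on_defs)

  define X where "X = (\<lambda>u. {v \<in> pverts G. c v = c u}) ` pverts G"
  \<comment> \<open>The centre of a cluster; the choice of \<open>u\<close> is immaterial because
    \<open>c\<close> is constant on each block.\<close>
  define f where "f A = c (SOME u. u \<in> A)" for A
  have f: "c u = f A" if "A \<in> X" "u \<in> A" for u A
    using that someI[of "\<lambda>u. u \<in> A" u] by (auto simp: X_def f_def)
  have X_verts: "u \<in> pverts G" if "A \<in> X" "u \<in> A" for u A
    using that by (auto simp: X_def)
  have X_ne: "\<exists>u. u \<in> A" if "A \<in> X" for A
    using that by (auto simp: X_def)
  have part: "partition_on (pverts G) X"
    by (intro partition_onI) (auto simp: X_def disjnt_def)
  have f_inj: "inj_on f X"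
  proof (rule inj_onI)
    fix A B assume AB: "A \<in> X" "B \<in> X" "f A = f B"
    obtain u v where uv: "u \<in> A" "v \<in> B" using AB X_ne by blast
    have "c u = c v" using AB uv f by metis
    then show "A = B" using AB uv by (auto simp: X_def)
  qed
  have f_verts: "f ` X \<subseteq> pverts G"
    using X_ne f c X_verts near_verts by (metis image_subsetI)

  let ?H = "graph_power G d"
  let ?Q = "quotient_graph ?H X"
  have H_verts: "pverts ?H = pverts G" by (simp add: graph_power_def)
  have "is_clique ?H A" if A: "A \<in> X" for A
    unfolding is_clique_def parcs_graph_power
  proof (intro conjI ballI impI)
    show "A \<subseteq> pverts ?H" using X_verts[OF A] by (auto simp: H_verts)
    fix u v assume uv: "u \<in> A" "v \<in> A"
    then have "near k u (f A)" "near k v (f A)" using c f[OF A] X_verts[OF A] by metis+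
    then have "near (k + k) u v" by (blast intro: near_trans near_sym)
    then show "near d u v" using k(1) by (auto intro: near_mono)
  qed
  then have clus: "clustering ?H X" using part by (simp add: clustering_def H_verts)

  have Q_verts: "pverts ?Q = X" by (simp add: quotient_graph_def)
  have Q: "pair_graph ?Q"
    using pair_graph_quotient_graph[OF pair_graph_graph_power[OF assms(1)]] part
    by (simp add: H_verts)
  interpret Q: pair_graph ?Q by (fact Q)

  have edge: "walk_above \<sigma> b (2 * d) (f A) (f B)"
    if "(A, B) \<in> parcs ?Q" and b: "(b, f A) \<in> \<sigma>" "(b, f B) \<in> \<sigma>" for A B b
  proof -
    from that(1) obtain u v where uv: "A \<in> X" "B \<in> X" "u \<in> A" "v \<in> B" "near d u v"
      unfolding quotient_graph_def using parcs_graph_power by auto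
    have cuv: "c u = f A" "c v = f B" "u \<in> pverts G" "v \<in> pverts G"
      using f X_verts uv by blast+
    have u: "(b, w) \<in> \<sigma>" if "near k u w" for w
      using c_least[OF cuv(3) that] b cuv trans by (auto dest: transD)
    have v: "(b, w) \<in> \<sigma>" if "near k v w" for w
      using c_least[OF cuv(4) that] b cuv trans by (auto dest: transD)
    \<comment> \<open>Radius \<open>k\<close> at \<open>x\<close> and radius 0 at the other end
      cover the walk: the ball of radius 0 is just \<open>c x\<close>, which is itself near
      \<open>x\<close>.\<close>
    have to_center: "walk_above \<sigma> b k x (c x)"
      if x: "x \<in> pverts G" "\<And>w. near k x w \<Longrightarrow> (b, w) \<in> \<sigma>" for x
    proof (rule walk_aboveI[of k x "c x" k 0])
      show "near k x (c x)" using c x(1) by blast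
      show "(b, w) \<in> \<sigma>" if "near 0 (c x) w" for w
        using that c x unfolding near_def by auto
    qed (use x(2) in auto)
    have "walk_above \<sigma> b k (f A) u"
      using to_center[OF cuv(3) u] cuv(1) by (metis walk_above_sym)
    moreover have "walk_above \<sigma> b d u v"
      using uv(5) k(2) u v by (rule walk_aboveI)
    moreover have "walk_above \<sigma> b k v (f B)"
      using to_center[OF cuv(4) v] cuv(2) by simp
    ultimately have "walk_above \<sigma> b (k + d + k) (f A) (f B)"
      by (blast intro: walk_above_trans)
    then show ?thesis using k(1) by (auto intro: walk_above_mono)
  qed
  \<comment> \<open>Each quotient edge is replaced by a walk of length at most \<open>2 * d\<close>
    between centres. A single \<open>b\<close> below all centres on the quotient walk serves every
    edge, so the pieces concatenate.\<close>
  have lift: "walk_above \<sigma> b (2 * d * length p) (f A) (f B)"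
    if "Q.awalk A p B" "\<forall>C\<in>set (Q.awalk_verts A p). (b, f C) \<in> \<sigma>" for A B b p
    using that
  proof (induction p arbitrary: A)
    case Nil
    then have "A = B" "A \<in> X" "(b, f A) \<in> \<sigma>" by (auto simp: Q.awalk_def Q_verts)
    then show ?case using f_verts unfolding walk_above_def
      by (intro exI[of _ "[]"]) (auto simp: awalk_def)
  next
    case (Cons e p)
    obtain C where e: "e = (A, C)" "(A, C) \<in> parcs ?Q" "Q.awalk C p B"
      using Cons.prems(1) by (cases e) (auto simp: Q.awalk_Cons_iff)
    have b: "(b, f A) \<in> \<sigma>" "\<forall>C\<in>set (Q.awalk_verts C p). (b, f C) \<in> \<sigma>"
      using Cons.prems(2) by (simp_all add: e(1))
    have "(b, f C) \<in> \<sigma>" using b(2) Q.start_in_awalk_verts[OF e(3)] by (rule bspec)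
    from walk_above_trans[OF edge[OF e(2) b(1) this] Cons.IH[OF e(3) b(2)]]
    show ?case by (simp add: algebra_simps)
  qed

  \<comment> \<open>Neither \<open>X\<close> nor \<open>\<tau>\<close> depends on \<open>r\<close>,
    so one clustering serves all \<open>r\<close>.\<close>
  define \<tau> where "\<tau> = {(A, B). A \<in> X \<and> B \<in> X \<and> (f A, f B) \<in> \<sigma>}"
  have lin: "linear_order_on (pverts ?Q) \<tau>"
    unfolding \<tau>_def Q_verts by (rule linear_order_on_inj_pullback[OF assms(2) f_inj f_verts])
  have reach: "f B \<in> WReach (2 * d * r) G \<sigma> (f A)" if "B \<in> WReach r ?Q \<tau> A" for A B r
  proof -
    from Q.WReachD[OF that] obtain p where p: "Q.awalk A p B" "length p \<le> r"
      "\<forall>C\<in>set (Q.awalk_verts A p). (B, C) \<in> \<tau>"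
      unfolding Q.walk_above_def by blast
    \<comment> \<open>By the choice of \<open>\<tau>\<close>, no cluster on the walk has its centre
      before \<open>f B\<close>, so \<open>lift\<close> applies with \<open>b = f B\<close>.\<close>
    have "\<forall>C\<in>set (Q.awalk_verts A p). (f B, f C) \<in> \<sigma>"
      using p(3) by (simp add: \<tau>_def)
    with p(1) have "walk_above \<sigma> (f B) (2 * d * length p) (f A) (f B)"
      by (rule lift)
    then show ?thesis using p(2) by (intro WReachI) (erule walk_above_mono, simp)
  qed
  have "wcol r ?Q \<le> wcol_ord (2 * d * r) G \<sigma>" for r
    using assms Q lin
    by (rule wcol_le_by_injection[where f = f]) (use f_inj f_verts reach in \<open>auto simp: Q_verts\<close>)
  with clus show ?thesis by blast
qed

end
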